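(* Let $d\ge 1$ be an integer, let $X_1,\dots,X_d$ be i.i.d. $1$-sub-Gaussian real random variables with variance $1$, and let $\epsilon>0$. Then $$\mathbb{P}\left(\frac{X_1^2+\dots+X_d^2}{d}\notin[1-\epsilon,\,1+\epsilon]\right)\ \le\ 2\,e^{-d\left(\frac{\epsilon^2-\epsilon^3}{4}\right)} .$$
   Context: A real random variable $X$ is called $1$-sub-Gaussian if $\mathbb{E}[e^{\lambda X}]\le e^{\lambda^2/2}$ for all $\lambda\in\mathbb{R}$ (this implies $\mathbb{E}[X]=0$ and $\mathrm{Var}[X]\le 1$). *)

theory Defs
  imports "HOL-Probability.Probability"
begin

text \<open>
  The integrability clause says that the moment generating function is finite everywhere. It has
  to be explicit because the Bochner integral of a non-integrable function is \<open>0\<close>.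
\<close>

definition one_subgaussian :: "'a measure \<Rightarrow> ('a \<Rightarrow> real) \<Rightarrow> bool" where
  "one_subgaussian M X \<longleftrightarrow>
     X \<in> borel_measurable M \<and>
     (\<forall>t::real. integrable M (\<lambda>\<omega>. exp (t * X \<omega>)) \<and>
                (LINT \<omega>|M. exp (t * X \<omega>)) \<le> exp (t\<^sup>2 / 2))"

definition iid_vars :: "'a measure \<Rightarrow> ('i \<Rightarrow> 'a \<Rightarrow> real) \<Rightarrow> 'i set \<Rightarrow> bool" where
  "iid_vars M X I \<longleftrightarrow>
     prob_space.indep_vars M (\<lambda>_. borel) X I \<and>
     (\<forall>i\<in>I. \<forall>j\<in>I. distr M borel (X i) = distr M borel (X j))"

end

theory Submission
  imports Defs "HOL-Real_Asymp.Real_Asymp"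
begin

text \<open>
  Chernoff bounds for both tails. For the upper tail, the sub-Gaussian bound averaged over a Gaussian
  gives \<open>E exp (c X\<^sup>2) \<le> 1 / sqrt (1 - 2 c)\<close>, used with \<open>c = \<epsilon> / (2 (1 + \<epsilon>))\<close>. For the lower tail,
  unit variance forces \<open>E X\<^sup>4 \<le> 3\<close>, so \<open>E exp (- c X\<^sup>2) \<le> 1 - c + 3 c\<^sup>2 / 2\<close>, used with
  \<open>c = \<epsilon> / 2\<close>. If \<open>\<epsilon> \<ge> 1\<close>, the claimed bound is at least \<open>2\<close>.
\<close>

section \<open>Elementary inequalities for exp, ln and cosh\<close>

lemma exp_minus_le_quadratic:
  fixes y :: real
  assumes "0 \<le> y"
  shows "exp (-y) \<le> 1 - y + y\<^sup>2 / 2"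
proof -
  have pos: "0 < 1 + y + y\<^sup>2 / 2"
    using assms by (simp add: add_pos_nonneg)
  \<comment> \<open>The product is \<open>(1 + y^2/2)^2 - y^2\<close>, so the alternating quadratic
    dominates the reciprocal of the Taylor lower bound for \<open>exp y\<close>.\<close>
  have "(1 + y + y\<^sup>2 / 2) * (1 - y + y\<^sup>2 / 2) = 1 + y ^ 4 / 4"
    by (simp add: power2_eq_square power4_eq_xxxx algebra_simps)
  then have "1 \<le> (1 + y + y\<^sup>2 / 2) * (1 - y + y\<^sup>2 / 2)"
    by simp
  then have "1 / (1 + y + y\<^sup>2 / 2) \<le> 1 - y + y\<^sup>2 / 2"
    using pos by (simp add: pos_divide_le_eq mult.commute)
  moreover have "exp (-y) \<le> 1 / (1 + y + y\<^sup>2 / 2)"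
    using exp_lower_Taylor_quadratic[OF assms] pos
    by (simp add: exp_minus inverse_eq_divide frac_le)
  ultimately show ?thesis by linarith
qed

text \<open>The difference of the two sides vanishes at 0 and has derivative
  \<open>- x^2 / (1 + x)\<close>, so it decreases towards 0 from the left.\<close>

lemma ln_one_plus_le_quadratic:
  fixes u :: real
  assumes "-1 < u" "u \<le> 0"
  shows "ln (1 + u) \<le> u - u\<^sup>2 / 2"
proof -
  have "\<exists>D. ((\<lambda>x. x - x\<^sup>2 / 2 - ln (1 + x)) has_real_derivative D) (at x) \<and> D \<le> 0"
    if "u \<le> x" "x \<le> 0" for x
  proof (intro exI conjI)
    have "-1 < x" using that assms by simp
    then show "((\<lambda>x. x - x\<^sup>2 / 2 - ln (1 + x)) has_real_derivative (- x\<^sup>2 / (1 + x))) (at x)"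
      by (auto intro!: derivative_eq_intros simp: field_simps power2_eq_square)
    show "- x\<^sup>2 / (1 + x) \<le> 0"
      using \<open>-1 < x\<close> by (simp add: divide_nonpos_pos)
  qed
  from DERIV_nonpos_imp_nonincreasing[OF assms(2) this] show ?thesis by simp
qed

text \<open>Again a sign of derivative argument. The cubic coefficient is 1/2 instead of the Taylor
  value 1/3 because half of this bound, minus \<open>u/2\<close>, is exactly
  \<open>- (u^2 - u^3)/4\<close>, the exponent wanted for the upper tail.\<close>

lemma ln_one_plus_le_cubic:
  fixes u :: real
  assumes "0 \<le> u"
  shows "ln (1 + u) \<le> u - u\<^sup>2 / 2 + u ^ 3 / 2"
proof -
  have "\<exists>D. ((\<lambda>x. x - x\<^sup>2 / 2 + x ^ 3 / 2 - ln (1 + x)) has_real_derivative D) (at x) \<and> 0 \<le> D"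
    if "0 \<le> x" "x \<le> u" for x
  proof (intro exI conjI)
    show "((\<lambda>x. x - x\<^sup>2 / 2 + x ^ 3 / 2 - ln (1 + x)) has_real_derivative
        (x\<^sup>2 + 3 * x ^ 3) / (2 * (1 + x))) (at x)"
      using that by (auto intro!: derivative_eq_intros
          simp: field_simps power2_eq_square power3_eq_cube)
    show "0 \<le> (x\<^sup>2 + 3 * x ^ 3) / (2 * (1 + x))"
      using that by simp
  qed
  from DERIV_nonneg_imp_nondecreasing[OF assms this] show ?thesis by simp
qed

text \<open>Only even powers occur in the series of cosh, so all its terms are nonnegative and any
  truncation is a lower bound.\<close>

lemma cosh_ge_quartic:
  fixes x :: real
  shows "1 + x\<^sup>2 / 2 + x ^ 4 / 24 \<le> cosh x"
proof -
  let ?f = "\<lambda>n. if even n then x ^ n /\<^sub>R fact n else 0"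
  have "sum ?f {..<5} \<le> suminf ?f"
    using cosh_converges[of x]
    by (intro sum_le_suminf) (auto simp: sums_iff zero_le_even_power)
  moreover have "suminf ?f = cosh x"
    using cosh_converges[of x] by (simp add: sums_iff)
  moreover have "sum ?f {..<5} = 1 + x\<^sup>2 / 2 + x ^ 4 / 24"
  proof -
    have "{..<5} = {0, 1, 2, 3, 4 :: nat}" by auto
    then show ?thesis by (simp add: fact_numeral inverse_eq_divide)
  qed
  ultimately show ?thesis by simp
qed

section \<open>Chernoff bound for independent sums\<close>

lemma (in prob_space) chernoff_indep_sum:
  fixes Y :: "'i \<Rightarrow> 'a \<Rightarrow> real"
  assumes I: "finite I" and indep: "indep_vars (\<lambda>_. borel) Y I"
    and B: "\<And>i. i \<in> I \<Longrightarrow> (\<integral>\<^sup>+\<omega>. ennreal (exp (Y i \<omega>)) \<partial>M) \<le> ennreal B" "0 \<le> B"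
  shows "prob {\<omega> \<in> space M. a \<le> (\<Sum>i\<in>I. Y i \<omega>)} \<le> exp (-a) * B ^ card I"
proof -
  have [measurable]: "Y i \<in> borel_measurable M" if "i \<in> I" for i
    using indep that by (auto simp: indep_vars_def)
  let ?Z = "\<lambda>\<omega>. \<Prod>i\<in>I. ennreal (exp (Y i \<omega>))"
  have exp_sum: "?Z \<omega> = ennreal (exp (\<Sum>i\<in>I. Y i \<omega>))" for \<omega>
    using I by (simp add: exp_sum prod_ennreal)
  \<comment> \<open>Exponentiating turns the sum into a product. Working with nonnegative integrals,
    Markov's inequality and the factorisation by independence raise no integrability
    obligations.\<close>
  have "{\<omega> \<in> space M. a \<le> (\<Sum>i\<in>I. Y i \<omega>)} = {\<omega> \<in> space M. 1 \<le> ennreal (exp (-a)) * ?Z \<omega>}"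
    unfolding exp_sum by (auto simp: ennreal_mult[symmetric] exp_add[symmetric])
  then have "emeasure M {\<omega> \<in> space M. a \<le> (\<Sum>i\<in>I. Y i \<omega>)}
      \<le> ennreal (exp (-a)) * (\<integral>\<^sup>+\<omega>. ?Z \<omega> * indicator (space M) \<omega> \<partial>M)"
    using nn_integral_Markov_inequality[of ?Z "space M" M "ennreal (exp (-a))"] by simp
  also have "(\<integral>\<^sup>+\<omega>. ?Z \<omega> * indicator (space M) \<omega> \<partial>M) = (\<integral>\<^sup>+\<omega>. ?Z \<omega> \<partial>M)"
    by (intro nn_integral_cong) simp
  also have "\<dots> = (\<Prod>i\<in>I. \<integral>\<^sup>+\<omega>. ennreal (exp (Y i \<omega>)) \<partial>M)"
    using I by (intro indep_vars_nn_integral indep_vars_compose2[OF indep]) auto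
  also have "\<dots> \<le> (\<Prod>i\<in>I. ennreal B)"
    using I B(1) by (induction I) (simp_all add: mult_mono del: prod_constant)
  also have "\<dots> = ennreal (B ^ card I)"
    using B by (simp add: ennreal_power)
  also have "ennreal (exp (-a)) * \<dots> = ennreal (exp (-a) * B ^ card I)"
    using B by (simp add: ennreal_mult)
  finally show ?thesis
    using B by (simp add: emeasure_eq_measure mult_left_mono)
qed

section \<open>Gaussian averaging and the exponential moment of the square\<close>

lemma nn_integral_normal_density:
  "0 < \<sigma> \<Longrightarrow> (\<integral>\<^sup>+z. ennreal (normal_density \<mu> \<sigma> z) \<partial>lborel) = 1"
  by (simp add: nn_integral_eq_integral)

lemma one_subgaussian_measurable: "one_subgaussian M X \<Longrightarrow> X \<in> borel_measurable M"
  by (simp add: one_subgaussian_def)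

lemma one_subgaussian_mgf:
  assumes "one_subgaussian M X"
  shows "integrable M (\<lambda>\<omega>. exp (t * X \<omega>))" "(LINT \<omega>|M. exp (t * X \<omega>)) \<le> exp (t\<^sup>2 / 2)"
  using assms by (simp_all add: one_subgaussian_def)

text \<open>Writing \<open>exp (s\<^sup>2 x\<^sup>2 / 2)\<close> as the moment generating function of a standard Gaussian \<open>z\<close> at
  \<open>s x\<close> and exchanging the integrals reduces the claim to the sub-Gaussian bound at \<open>s z\<close>.\<close>

lemma (in prob_space) nn_integral_exp_square_le:
  fixes X :: "'a \<Rightarrow> real" and c :: real
  assumes X: "one_subgaussian M X" and c: "0 \<le> c" "c < 1 / 2"
  shows "(\<integral>\<^sup>+\<omega>. ennreal (exp (c * (X \<omega>)\<^sup>2)) \<partial>M) \<le> ennreal (1 / sqrt (1 - 2 * c))"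
proof -
  have [measurable]: "X \<in> borel_measurable M"
    using X by (rule one_subgaussian_measurable)
  interpret lM: pair_sigma_finite lborel M ..
  define s where "s = sqrt (2 * c)"
  have s2: "s\<^sup>2 = 2 * c" using c by (simp add: s_def)
  \<comment> \<open>Tilting the standard normal density by \<open>exp (s^2 z^2 / 2)\<close> leaves
    precision \<open>1 - 2c\<close>, positive as \<open>c < 1/2\<close>. The result is a Gaussian
    density of standard deviation \<open>\<sigma>\<close> scaled by \<open>\<sigma>\<close>, hence
    of total mass \<open>\<sigma>\<close>.\<close>
  define \<sigma> where "\<sigma> = 1 / sqrt (1 - 2 * c)"
  have \<sigma>: "\<sigma> > 0" "\<sigma>\<^sup>2 = 1 / (1 - 2 * c)" using c by (simp_all add: \<sigma>_def power_divide)
  \<comment> \<open>Completing the square in \<open>z\<close>, with \<open>s^2 = 2c\<close>: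
    integrating the left side over \<open>z\<close> gives back \<open>exp (c x^2)\<close>.\<close>
  have mgf: "exp (c * x\<^sup>2) * normal_density (s * x) 1 z = std_normal_density z * exp ((s * z) * x)"
    for x z :: real
  proof -
    have "c * x\<^sup>2 - (z - s * x)\<^sup>2 / 2 = - z\<^sup>2 / 2 + s * z * x"
      using s2 by (simp add: power2_eq_square field_simps)
    then show ?thesis
      by (simp add: normal_density_def exp_add[symmetric] mult.commute)
  qed
  have tilt: "std_normal_density z * exp ((s * z)\<^sup>2 / 2) = \<sigma> * normal_density 0 \<sigma> z" for z
  proof -
    have "- z\<^sup>2 / 2 + (s * z)\<^sup>2 / 2 = - z\<^sup>2 / (2 * \<sigma>\<^sup>2)"
      using c by (simp add: \<sigma>(2) s2 power_mult_distrib field_simps)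
    then show ?thesis
      using \<sigma>(1) by (simp add: normal_density_def real_sqrt_mult exp_add[symmetric])
  qed
  have "(\<integral>\<^sup>+\<omega>. ennreal (exp (c * (X \<omega>)\<^sup>2)) \<partial>M)
      = (\<integral>\<^sup>+\<omega>. (\<integral>\<^sup>+z. ennreal (exp (c * (X \<omega>)\<^sup>2)) * ennreal (normal_density (s * X \<omega>) 1 z) \<partial>lborel) \<partial>M)"
    by (simp add: nn_integral_cmult nn_integral_normal_density)
  also have "\<dots> = (\<integral>\<^sup>+\<omega>. (\<integral>\<^sup>+z. ennreal (std_normal_density z * exp ((s * z) * X \<omega>)) \<partial>lborel) \<partial>M)"
    by (simp add: ennreal_mult[symmetric] mgf)
  also have "\<dots> = (\<integral>\<^sup>+z. (\<integral>\<^sup>+\<omega>. ennreal (std_normal_density z * exp ((s * z) * X \<omega>)) \<partial>M) \<partial>lborel)"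
    by (rule lM.Fubini') measurable
  also have "\<dots> \<le> (\<integral>\<^sup>+z. ennreal \<sigma> * ennreal (normal_density 0 \<sigma> z) \<partial>lborel)"
  proof (rule nn_integral_mono)
    fix z :: real
    have "(\<integral>\<^sup>+\<omega>. ennreal (std_normal_density z * exp ((s * z) * X \<omega>)) \<partial>M)
        = ennreal (std_normal_density z) * ennreal (LINT \<omega>|M. exp ((s * z) * X \<omega>))"
      by (simp add: ennreal_mult nn_integral_cmult
          nn_integral_eq_integral[OF one_subgaussian_mgf(1)[OF X]])
    also have "\<dots> \<le> ennreal (std_normal_density z) * ennreal (exp ((s * z)\<^sup>2 / 2))"
      by (intro mult_left_mono ennreal_leI one_subgaussian_mgf(2)[OF X]) simp
    also have "\<dots> = ennreal \<sigma> * ennreal (normal_density 0 \<sigma> z)"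
      using \<sigma>(1) by (simp add: ennreal_mult[symmetric] tilt)
    finally show "(\<integral>\<^sup>+\<omega>. ennreal (std_normal_density z * exp ((s * z) * X \<omega>)) \<partial>M)
        \<le> ennreal \<sigma> * ennreal (normal_density 0 \<sigma> z)" .
  qed
  also have "\<dots> = ennreal \<sigma>"
    using \<sigma>(1) by (simp add: nn_integral_cmult nn_integral_normal_density)
  finally show ?thesis by (simp add: \<sigma>_def)
qed

section \<open>Mean and moments of a sub-Gaussian variable\<close>

lemma (in prob_space) one_subgaussian_expectation:
  fixes X :: "'a \<Rightarrow> real"
  assumes X: "one_subgaussian M X" and int: "integrable M X"
  shows "expectation X = 0"
proof -
  \<comment> \<open>Linearise the exponential. Dividing by \<open>t > 0\<close> and letting
    \<open>t\<close> tend to 0 bounds the mean above by 0; the same inequality at \<open>-t\<close>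
    bounds it below.\<close>
  have bound: "t * expectation X \<le> exp (t\<^sup>2 / 2) - 1" for t
  proof -
    have "expectation (\<lambda>\<omega>. 1 + t * X \<omega>) \<le> expectation (\<lambda>\<omega>. exp (t * X \<omega>))"
      using int one_subgaussian_mgf(1)[OF X] by (intro integral_mono exp_ge_add_one_self) auto
    then show ?thesis
      using int one_subgaussian_mgf(2)[OF X, of t] by (simp add: prob_space)
  qed
  have lim: "((\<lambda>t::real. (exp (t\<^sup>2 / 2) - 1) / t) \<longlongrightarrow> 0) (at_right 0)"
    by real_asymp
  have "eventually (\<lambda>t. expectation X \<le> (exp (t\<^sup>2 / 2) - 1) / t) (at_right 0)"
    using bound by (auto simp: eventually_at_right_field pos_le_divide_eq mult.commute intro: exI[of _ 1])
  then have "expectation X \<le> 0"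
    by (rule tendsto_lowerbound[OF lim]) simp
  moreover have "eventually (\<lambda>t. - expectation X \<le> (exp (t\<^sup>2 / 2) - 1) / t) (at_right 0)"
    using bound[of "- t" for t]
    by (auto simp: eventually_at_right_field pos_le_divide_eq mult.commute intro: exI[of _ 1])
  then have "- expectation X \<le> 0"
    by (rule tendsto_lowerbound[OF lim]) simp
  ultimately show ?thesis by simp
qed

text \<open>The moment generating function at 1 and -1 makes \<open>cosh (X \<omega>)\<close>
  integrable, and cosh dominates the second and fourth powers up to constants. A square integrable
  variable on a probability space is integrable.\<close>

lemma (in prob_space) one_subgaussian_moments:
  fixes X :: "'a \<Rightarrow> real"
  assumes X: "one_subgaussian M X"
  shows "integrable M (\<lambda>\<omega>. X \<omega> ^ 4)" "integrable M (\<lambda>\<omega>. (X \<omega>)\<^sup>2)" "integrable M X"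
proof -
  have [measurable]: "X \<in> borel_measurable M"
    using X by (rule one_subgaussian_measurable)
  have cosh_int: "integrable M (\<lambda>\<omega>. cosh (X \<omega>))"
    using one_subgaussian_mgf(1)[OF X, of 1] one_subgaussian_mgf(1)[OF X, of "-1"]
    by (simp add: cosh_field_def)
  show "integrable M (\<lambda>\<omega>. X \<omega> ^ 4)"
  proof (rule Bochner_Integration.integrable_bound)
    show "integrable M (\<lambda>\<omega>. 24 * cosh (X \<omega>))" using cosh_int by simp
    have "x ^ 4 \<le> 24 * cosh x" for x :: real
      using cosh_ge_quartic[of x] zero_le_power2[of x] by argo
    then show "AE \<omega> in M. norm (X \<omega> ^ 4) \<le> norm (24 * cosh (X \<omega>))" by simp
  qed measurable
  show X2: "integrable M (\<lambda>\<omega>. (X \<omega>)\<^sup>2)"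
  proof (rule Bochner_Integration.integrable_bound)
    show "integrable M (\<lambda>\<omega>. 2 * cosh (X \<omega>))" using cosh_int by simp
    have "x\<^sup>2 \<le> 2 * cosh x" for x :: real
    proof -
      have "0 \<le> x ^ 4" by simp
      then show ?thesis using cosh_ge_quartic[of x] by linarith
    qed
    then show "AE \<omega> in M. norm ((X \<omega>)\<^sup>2) \<le> norm (2 * cosh (X \<omega>))" by simp
  qed measurable
  show "integrable M X"
    by (rule square_integrable_imp_integrable[OF _ X2]) measurable
qed

text \<open>Compare the Taylor coefficients at \<open>0\<close> of the symmetrised moment generating function and of
  \<open>exp (t\<^sup>2 / 2)\<close>: unit variance makes the quadratic terms cancel, so the quartic ones are ordered.\<close>

lemma (in prob_space) one_subgaussian_fourth_moment:
  fixes X :: "'a \<Rightarrow> real"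
  assumes X: "one_subgaussian M X" and var: "expectation (\<lambda>\<omega>. (X \<omega>)\<^sup>2) = 1"
  shows "expectation (\<lambda>\<omega>. X \<omega> ^ 4) \<le> 3"
proof -
  note moments = one_subgaussian_moments[OF X]
  have bound: "1 + t\<^sup>2 / 2 + t ^ 4 / 24 * expectation (\<lambda>\<omega>. X \<omega> ^ 4) \<le> exp (t\<^sup>2 / 2)" for t
  proof -
    have "1 + t\<^sup>2 / 2 + t ^ 4 / 24 * expectation (\<lambda>\<omega>. X \<omega> ^ 4)
        = expectation (\<lambda>\<omega>. 1 + t\<^sup>2 / 2 * (X \<omega>)\<^sup>2 + t ^ 4 / 24 * X \<omega> ^ 4)"
      using moments var by (simp add: prob_space)
    also have "\<dots> \<le> expectation (\<lambda>\<omega>. (exp (t * X \<omega>) + exp (- t * X \<omega>)) / 2)"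
    proof (rule integral_mono)
      show "integrable M (\<lambda>\<omega>. 1 + t\<^sup>2 / 2 * (X \<omega>)\<^sup>2 + t ^ 4 / 24 * X \<omega> ^ 4)"
        using moments by simp
      show "integrable M (\<lambda>\<omega>. (exp (t * X \<omega>) + exp (- t * X \<omega>)) / 2)"
        using one_subgaussian_mgf(1)[OF X, of t] one_subgaussian_mgf(1)[OF X, of "-t"] by simp
      show "1 + t\<^sup>2 / 2 * (X \<omega>)\<^sup>2 + t ^ 4 / 24 * X \<omega> ^ 4 \<le> (exp (t * X \<omega>) + exp (- t * X \<omega>)) / 2"
        for \<omega>
        using cosh_ge_quartic[of "t * X \<omega>"] by (simp add: cosh_field_def power_mult_distrib)
    qed
    also have "\<dots> \<le> exp (t\<^sup>2 / 2)"
      using one_subgaussian_mgf[OF X, of t] one_subgaussian_mgf[OF X, of "-t"] by simp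
    finally show ?thesis .
  qed
  \<comment> \<open>The coefficient of \<open>t^4\<close> in \<open>exp (t^2 / 2)\<close> is 1/8, so
    the limit is 24/8 = 3, the fourth moment of a standard Gaussian.\<close>
  have lim: "((\<lambda>t::real. 24 * (exp (t\<^sup>2 / 2) - 1 - t\<^sup>2 / 2) / t ^ 4) \<longlongrightarrow> 3) (at_right 0)"
    by real_asymp
  have "eventually (\<lambda>t. expectation (\<lambda>\<omega>. X \<omega> ^ 4) \<le> 24 * (exp (t\<^sup>2 / 2) - 1 - t\<^sup>2 / 2) / t ^ 4)
      (at_right 0)"
    using eventually_at_right_less[of "0::real"]
  proof eventually_elim
    case (elim t)
    then show ?case using bound[of t] by (simp add: pos_le_divide_eq field_simps)
  qed
  then show ?thesis
    by (rule tendsto_lowerbound[OF lim]) simp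
qed

text \<open>Integrate the quadratic upper bound for \<open>exp (- y)\<close> at
  \<open>y = c X^2\<close>; the second moment 1 and the fourth moment bound 3 give the
  coefficients.\<close>

lemma (in prob_space) nn_integral_exp_minus_square_le:
  fixes X :: "'a \<Rightarrow> real" and c :: real
  assumes X: "one_subgaussian M X" and var: "expectation (\<lambda>\<omega>. (X \<omega>)\<^sup>2) = 1" and c: "0 \<le> c"
  shows "(\<integral>\<^sup>+\<omega>. ennreal (exp (- c * (X \<omega>)\<^sup>2)) \<partial>M) \<le> ennreal (1 - c + 3 / 2 * c\<^sup>2)"
proof -
  note moments = one_subgaussian_moments[OF X]
  let ?q = "\<lambda>\<omega>. 1 - c * (X \<omega>)\<^sup>2 + c\<^sup>2 / 2 * X \<omega> ^ 4"
  have le: "exp (- c * (X \<omega>)\<^sup>2) \<le> ?q \<omega>" for \<omega>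
    using exp_minus_le_quadratic[of "c * (X \<omega>)\<^sup>2"] c by (simp add: power_mult_distrib)
  have "(\<integral>\<^sup>+\<omega>. ennreal (exp (- c * (X \<omega>)\<^sup>2)) \<partial>M) \<le> (\<integral>\<^sup>+\<omega>. ennreal (?q \<omega>) \<partial>M)"
    by (intro nn_integral_mono ennreal_leI le)
  also have "\<dots> = ennreal (expectation ?q)"
    using moments
    \<comment> \<open>The quadratic is nonnegative because it dominates an exponential.\<close>
    by (intro nn_integral_eq_integral AE_I2 order.trans[OF exp_ge_zero le]) auto
  also have "expectation ?q = 1 - c + c\<^sup>2 / 2 * expectation (\<lambda>\<omega>. X \<omega> ^ 4)"
    using moments var by (simp add: prob_space)
  also have "ennreal \<dots> \<le> ennreal (1 - c + 3 / 2 * c\<^sup>2)"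
    using mult_left_mono[OF one_subgaussian_fourth_moment[OF X var], of "c\<^sup>2 / 2"]
    by (intro ennreal_leI) simp
  finally show ?thesis .
qed

section \<open>Chernoff factors per variable against the claimed rate\<close>

lemma upper_tail_rate:
  fixes \<epsilon> :: real
  assumes "0 < \<epsilon>"
  shows "exp (- (\<epsilon> / 2)) * sqrt (1 + \<epsilon>) \<le> exp (- ((\<epsilon>\<^sup>2 - \<epsilon> ^ 3) / 4))"
proof -
  have "sqrt (1 + \<epsilon>) = exp (ln (1 + \<epsilon>) / 2)"
    using assms by (simp add: ln_sqrt[symmetric])
  then have "exp (- (\<epsilon> / 2)) * sqrt (1 + \<epsilon>) = exp (- (\<epsilon> / 2) + ln (1 + \<epsilon>) / 2)"
    by (simp add: exp_add[symmetric])
  then show ?thesis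
    using ln_one_plus_le_cubic[of \<epsilon>] assms by (simp add: field_simps)
qed

text \<open>The left side is the Chernoff factor of one variable at \<open>c = \<epsilon>/2\<close>.
  After taking logarithms, both exponents agree up to second order in \<epsilon> and the cubic and
  quartic remainders have the right sign.\<close>

lemma lower_tail_rate:
  fixes \<epsilon> :: real
  assumes "0 < \<epsilon>" "\<epsilon> < 1"
  shows "exp (\<epsilon> / 2 * (1 - \<epsilon>)) * (1 - \<epsilon> / 2 + 3 / 2 * (\<epsilon> / 2)\<^sup>2) \<le> exp (- ((\<epsilon>\<^sup>2 - \<epsilon> ^ 3) / 4))"
proof -
  define u where "u = - (\<epsilon> / 2) + 3 / 2 * (\<epsilon> / 2)\<^sup>2"
  have "u = - (\<epsilon> / 2 * (1 - 3 / 4 * \<epsilon>))"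
    by (simp add: u_def power2_eq_square field_simps)
  moreover have "0 \<le> \<epsilon> / 2 * (1 - 3 / 4 * \<epsilon>)"
    using assms by (intro mult_nonneg_nonneg) auto
  ultimately have "u \<le> 0" by simp
  have "-1 < u"
    using assms zero_le_power2[of "\<epsilon> / 2"] unfolding u_def by linarith
  note u = this \<open>u \<le> 0\<close>
  \<comment> \<open>The first bracket is the largest value of \<open>ln (1 + u)\<close> compatible
    with the claimed exponent, so the difference is the slack left by the quadratic bound for
    ln.\<close>
  have "(- (\<epsilon> / 2) + \<epsilon>\<^sup>2 / 4 + \<epsilon> ^ 3 / 4) - (u - u\<^sup>2 / 2) = \<epsilon> ^ 3 / 16 + 9 / 128 * \<epsilon> ^ 4"
    by (simp add: u_def power2_eq_square power3_eq_cube power4_eq_xxxx field_simps)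
  moreover have "0 \<le> \<epsilon> ^ 3 / 16 + 9 / 128 * \<epsilon> ^ 4" using assms by simp
  ultimately have "u - u\<^sup>2 / 2 \<le> - (\<epsilon> / 2) + \<epsilon>\<^sup>2 / 4 + \<epsilon> ^ 3 / 4"
    by (metis diff_ge_0_iff_ge)
  then have "ln (1 + u) \<le> - (\<epsilon> / 2) + \<epsilon>\<^sup>2 / 4 + \<epsilon> ^ 3 / 4"
    using ln_one_plus_le_quadratic[OF u] by (rule order.trans[rotated])
  then have "\<epsilon> / 2 - \<epsilon>\<^sup>2 / 2 + ln (1 + u) \<le> - ((\<epsilon>\<^sup>2 - \<epsilon> ^ 3) / 4)"
    by (simp add: field_simps)
  moreover have "\<epsilon> / 2 * (1 - \<epsilon>) = \<epsilon> / 2 - \<epsilon>\<^sup>2 / 2"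
    by (simp add: power2_eq_square field_simps)
  ultimately have "\<epsilon> / 2 * (1 - \<epsilon>) + ln (1 + u) \<le> - ((\<epsilon>\<^sup>2 - \<epsilon> ^ 3) / 4)"
    by (simp only:)
  moreover have "exp (\<epsilon> / 2 * (1 - \<epsilon>)) * (1 + u) = exp (\<epsilon> / 2 * (1 - \<epsilon>) + ln (1 + u))"
    using u by (simp add: exp_add)
  ultimately have "exp (\<epsilon> / 2 * (1 - \<epsilon>)) * (1 + u) \<le> exp (- ((\<epsilon>\<^sup>2 - \<epsilon> ^ 3) / 4))"
    by (simp only: exp_le_cancel_iff)
  then show ?thesis by (simp add: u_def algebra_simps)
qed

section \<open>Union bound over the two tails\<close>

theorem proposition1:
  fixes M :: "'a measure" and X :: "nat \<Rightarrow> 'a \<Rightarrow> real" and d :: nat and \<epsilon> :: real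
  assumes "prob_space M"
    and "d \<ge> 1"
    and "iid_vars M X {1..d}"
    and "\<And>i. i \<in> {1..d} \<Longrightarrow> one_subgaussian M (X i)"
    and "\<And>i. i \<in> {1..d} \<Longrightarrow> prob_space.variance M (X i) = 1"
    and "\<epsilon> > 0"
  shows "measure M {\<omega> \<in> space M. (\<Sum>i=1..d. (X i \<omega>)\<^sup>2) / real d \<notin> {1 - \<epsilon>..1 + \<epsilon>}}
           \<le> 2 * exp (- (real d * ((\<epsilon>^2 - \<epsilon>^3) / 4)))"
proof -
  interpret prob_space M by fact
  let ?r = "exp (- ((\<epsilon>\<^sup>2 - \<epsilon> ^ 3) / 4))"
  let ?S = "\<lambda>\<omega>. \<Sum>i=1..d. (X i \<omega>)\<^sup>2"
  let ?A = "{\<omega> \<in> space M. ?S \<omega> / real d \<notin> {1 - \<epsilon>..1 + \<epsilon>}}"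
  have rate: "exp (- (real d * ((\<epsilon>^2 - \<epsilon>^3) / 4))) = ?r ^ d"
    by (simp add: exp_of_nat_mult[symmetric])
  note sub = assms(4)
  have [measurable]: "X i \<in> borel_measurable M" if "i \<in> {1..d}" for i
    using sub[OF that] by (rule one_subgaussian_measurable)
  have indep: "indep_vars (\<lambda>_. borel) X {1..d}"
    using assms(3) by (simp add: iid_vars_def)
  \<comment> \<open>The mean is 0, so the variance is the second moment.\<close>
  have second: "expectation (\<lambda>\<omega>. (X i \<omega>)\<^sup>2) = 1" if "i \<in> {1..d}" for i
    using assms(5)[OF that] one_subgaussian_expectation[OF sub[OF that]]
      one_subgaussian_moments(3)[OF sub[OF that]] by simp
  \<comment> \<open>The sign of \<open>c\<close> is free: positive for the upper tail, negative for
    the lower one.\<close>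
  have chernoff: "prob {\<omega> \<in> space M. a \<le> c * ?S \<omega>} \<le> exp (- a) * B ^ d"
    if "\<And>i. i \<in> {1..d} \<Longrightarrow> (\<integral>\<^sup>+\<omega>. ennreal (exp (c * (X i \<omega>)\<^sup>2)) \<partial>M) \<le> ennreal B" "0 \<le> B"
    for a c B
    using chernoff_indep_sum[of "{1..d}" "\<lambda>i \<omega>. c * (X i \<omega>)\<^sup>2" B a] that
      indep_vars_compose2[OF indep, of "\<lambda>_ x. c * x\<^sup>2" "\<lambda>_. borel"]
    by (simp add: sum_distrib_left)
  show ?thesis
  proof (cases "\<epsilon> < 1")
    case False
    then have "\<epsilon>\<^sup>2 \<le> \<epsilon> ^ 3" by (intro power_increasing) auto
    then have "1 \<le> ?r" by simp
    then have "1 \<le> ?r ^ d" by (rule one_le_power)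
    then show ?thesis unfolding rate using prob_le_1[of ?A] by linarith
  next
    case True
    \<comment> \<open>This \<open>c\<close> minimises
      \<open>exp (- c (1 + \<epsilon>)) / sqrt (1 - 2c)\<close>: the stationarity condition is
      \<open>1 - 2c = 1 / (1 + \<epsilon>)\<close>.\<close>
    define c where "c = \<epsilon> / (2 * (1 + \<epsilon>))"
    have c: "0 \<le> c" "c < 1 / 2" "1 - 2 * c = 1 / (1 + \<epsilon>)" "c * (1 + \<epsilon>) = \<epsilon> / 2"
      using assms(6) by (simp_all add: c_def field_simps)
    let ?U = "{\<omega> \<in> space M. real d * (c * (1 + \<epsilon>)) \<le> c * ?S \<omega>}"
    \<comment> \<open>Multiplying by \<open>- \<epsilon>/2\<close> turns the lower tail into an
      upper tail.\<close>
    let ?L = "{\<omega> \<in> space M. - real d * (\<epsilon> / 2 * (1 - \<epsilon>)) \<le> - (\<epsilon> / 2) * ?S \<omega>}"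
    have "?A \<subseteq> ?U \<union> ?L"
    proof
      fix \<omega> assume "\<omega> \<in> ?A"
      then consider "\<omega> \<in> space M" "real d * (1 + \<epsilon>) \<le> ?S \<omega>"
        | "\<omega> \<in> space M" "?S \<omega> \<le> real d * (1 - \<epsilon>)"
        using assms(2) by (auto simp: not_le field_simps)
      then show "\<omega> \<in> ?U \<union> ?L"
      proof cases
        case 1
        then show ?thesis using mult_left_mono[OF 1(2) c(1)] by (simp add: mult_ac)
      next
        case 2
        then show ?thesis using mult_left_mono[OF 2(2), of "\<epsilon> / 2"] assms(6) by (simp add: mult_ac)
      qed
    qed
    then have "prob ?A \<le> prob ?U + prob ?L"
      by (intro order.trans[OF finite_measure_mono measure_Un_le]) measurable
    moreover have "prob ?U \<le> ?r ^ d"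
    proof -
      have "prob ?U \<le> exp (- (real d * (c * (1 + \<epsilon>)))) * (1 / sqrt (1 - 2 * c)) ^ d"
        using c assms(6) by (intro chernoff nn_integral_exp_square_le sub) auto
      also have "\<dots> = (exp (- (\<epsilon> / 2)) * sqrt (1 + \<epsilon>)) ^ d"
        using assms(6) unfolding c power_mult_distrib exp_of_nat_mult[symmetric]
        by (simp add: real_sqrt_divide)
      also have "\<dots> \<le> ?r ^ d"
        using upper_tail_rate[OF assms(6)] assms(6) by (intro power_mono) auto
      finally show ?thesis .
    qed
    moreover have "prob ?L \<le> ?r ^ d"
    proof -
      have pos: "0 \<le> 1 - \<epsilon> / 2 + 3 / 2 * (\<epsilon> / 2)\<^sup>2"
        using True by (intro add_nonneg_nonneg) auto
      have "prob ?L \<le> exp (- (- real d * (\<epsilon> / 2 * (1 - \<epsilon>)))) * (1 - \<epsilon> / 2 + 3 / 2 * (\<epsilon> / 2)\<^sup>2) ^ d"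
        using assms(6) by (intro chernoff nn_integral_exp_minus_square_le sub second pos) auto
      also have "\<dots> = (exp (\<epsilon> / 2 * (1 - \<epsilon>)) * (1 - \<epsilon> / 2 + 3 / 2 * (\<epsilon> / 2)\<^sup>2)) ^ d"
        by (simp add: power_mult_distrib exp_of_nat_mult[symmetric])
      also have "\<dots> \<le> ?r ^ d"
        using lower_tail_rate[OF assms(6) True] pos by (intro power_mono mult_nonneg_nonneg) auto
      finally show ?thesis .
    qed
    ultimately show ?thesis unfolding rate by linarith
  qed
qed

end
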